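(* Let $T: E \to E$ be a positive and weakly almost periodic linear operator on a complex Banach lattice $E$. Assume that for each $f \in E_+$ there exists an integer $n \ge 1$ (possibly depending on $f$) such that $\overline{E_{T^n f}} \supseteq \overline{E_{T^{n-1} f}}$. Then $\sigma_{\mathrm{pnt}}(T) \cap \mathbb{T} \subseteq \{1\}$.
   Context: $E_+$ denotes the positive cone of the Banach lattice $E$. For $u \in E_+$, the principal ideal generated by $u$ is $E_u := \{f \in E : \exists c \ge 0 \text{ with } |f| \le cu\}$, and $\overline{E_u}$ is its norm closure in $E$. A linear operator $T$ is positive if $T E_+ \subseteq E_+$. $T$ is weakly almost periodic if for each $f \in E$ the orbit $\{T^n f : n \ge 0\}$ is relatively compact with respect to the weak topology on $E$. $\mathbb{T} := \{\lambda \in \mathbb{C} : |\lambda| = 1\}$, and $\sigma_{\mathrm{pnt}}(T)$ denotes the point spectrum (set of eigenvalues) of $T$. *)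

theory Defs
  imports "HOL-Analysis.Analysis" "HOL-Library.Lattice_Algebras"
begin

section \<open>Real Banach lattices\<close>

class banach_lattice = banach + lattice_ab_group_add_abs + ordered_real_vector +
  assumes norm_mono_abs: "\<bar>x\<bar> \<le> \<bar>y\<bar> \<Longrightarrow> norm x \<le> norm y"

instance real :: banach_lattice
  by standard simp

lemma norm_abs_lattice: "norm \<bar>x\<bar> = norm (x :: 'a::banach_lattice)"
  by (intro antisym norm_mono_abs) simp_all

lemma norm_mono_nonneg:
  fixes x y :: "'a::banach_lattice"
  assumes "0 \<le> x" "x \<le> y"
  shows "norm x \<le> norm y"
  using assms by (intro norm_mono_abs) simp

lemma lattice_le_LIMSEQ:
  fixes a b :: "'a::banach_lattice"
  assumes X: "X \<longlonglongrightarrow> a" and Y: "Y \<longlonglongrightarrow> b" and le: "\<And>n. X n \<le> Y n"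
  shows "a \<le> b"
proof -
  define p where "p = sup (a - b) 0"
  have Z: "(\<lambda>n. (Y n - X n) - (b - a)) \<longlonglongrightarrow> 0"
    using tendsto_diff[OF tendsto_diff[OF Y X] tendsto_const[of "b - a"]] by simp
  have bound: "norm p \<le> norm ((Y n - X n) - (b - a))" for n
  proof -
    have "a - b \<le> (Y n - X n) - (b - a)"
      using le[of n] by (simp add: algebra_simps)
    also have "\<dots> \<le> \<bar>(Y n - X n) - (b - a)\<bar>" by (rule abs_ge_self)
    finally have "p \<le> \<bar>(Y n - X n) - (b - a)\<bar>"
      unfolding p_def by simp
    moreover have "0 \<le> p" unfolding p_def by simp
    ultimately show ?thesis
      using norm_mono_nonneg norm_abs_lattice by metis
  qed
  have "(\<lambda>n. norm ((Y n - X n) - (b - a))) \<longlonglongrightarrow> 0"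
    using tendsto_norm_zero[OF Z] .
  hence "norm p \<le> 0"
    by (rule LIMSEQ_le_const) (use bound in auto)
  hence "p = 0" by simp
  hence "a - b \<le> 0" unfolding p_def using sup.cobounded1 by metis
  thus ?thesis by simp
qed


section \<open>Complex Banach lattices\<close>

text \<open>A complex Banach lattice is the complexification \<open>E\<^sub>\<real> + i E\<^sub>\<real>\<close> of a real Banach lattice
  \<open>E\<^sub>\<real>\<close>, ordered by the cone \<open>{x + i 0 | x \<ge> 0}\<close> and normed by the norm of the modulus.\<close>

datatype 'a complexification = Cplx (re_part: 'a) (im_part: 'a)

lemma complexification_eqI:
  "re_part z = re_part w \<Longrightarrow> im_part z = im_part w \<Longrightarrow> z = w"
  by (cases z; cases w) simp

lemma complexification_eq_iff:
  "z = w \<longleftrightarrow> re_part z = re_part w \<and> im_part z = im_part w"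
  by (cases z; cases w) simp

instantiation complexification :: (real_vector) real_vector
begin

definition "0 = Cplx 0 0"
definition "z + w = Cplx (re_part z + re_part w) (im_part z + im_part w)"
definition "z - w = Cplx (re_part z - re_part w) (im_part z - im_part w)"
definition "- z = Cplx (- re_part z) (- im_part z)"
definition "r *\<^sub>R z = Cplx (r *\<^sub>R re_part z) (r *\<^sub>R im_part z)"

instance
  by standard
    (simp_all add: zero_complexification_def plus_complexification_def minus_complexification_def
      uminus_complexification_def scaleR_complexification_def complexification_eq_iff
      algebra_simps)

end

lemma complexification_parts [simp]:
  "re_part 0 = 0" "im_part 0 = 0"
  "re_part (z + w) = re_part z + re_part w" "im_part (z + w) = im_part z + im_part w"
  "re_part (z - w) = re_part z - re_part w" "im_part (z - w) = im_part z - im_part w"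
  "re_part (- z) = - re_part z" "im_part (- z) = - im_part z"
  "re_part (r *\<^sub>R z) = r *\<^sub>R re_part z" "im_part (r *\<^sub>R z) = r *\<^sub>R im_part z"
  by (simp_all add: zero_complexification_def plus_complexification_def
      minus_complexification_def uminus_complexification_def scaleR_complexification_def)

definition scaleC :: "complex \<Rightarrow> 'a::real_vector complexification \<Rightarrow> 'a complexification"
    (infixr "*\<^sub>C" 75)
  where "c *\<^sub>C z = Cplx (Re c *\<^sub>R re_part z - Im c *\<^sub>R im_part z)
                       (Re c *\<^sub>R im_part z + Im c *\<^sub>R re_part z)"

lemma scaleC_parts [simp]:
  "re_part (c *\<^sub>C z) = Re c *\<^sub>R re_part z - Im c *\<^sub>R im_part z"
  "im_part (c *\<^sub>C z) = Re c *\<^sub>R im_part z + Im c *\<^sub>R re_part z"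
  by (simp_all add: scaleC_def)

interpretation complexification: vector_space scaleC
  by standard (simp_all add: complexification_eq_iff algebra_simps)

lemma scaleC_of_real: "complex_of_real r *\<^sub>C z = r *\<^sub>R z"
  by (simp add: complexification_eq_iff)

instantiation complexification :: (ordered_real_vector) ordered_real_vector
begin

definition "z \<le> w \<longleftrightarrow> re_part z \<le> re_part w \<and> im_part z = im_part w"
definition "z < w \<longleftrightarrow> re_part z < re_part w \<and> im_part z = im_part w"

instance
  by standard
    (auto simp: less_eq_complexification_def less_complexification_def complexification_eq_iff
      scaleR_left_mono scaleR_right_mono)

end

text \<open>The modulus in the underlying real Banach lattice:
  \<open>|x + i y| = sup\<^sub>\<theta> (cos \<theta> x + sin \<theta> y)\<close>. The supremum is shown to exist below.\<close>

definition real_modulus :: "'a::banach_lattice complexification \<Rightarrow> 'a"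
  where "real_modulus z = (LEAST m. \<forall>\<theta>. cos \<theta> *\<^sub>R re_part z + sin \<theta> *\<^sub>R im_part z \<le> m)"

lemma real_modulus_exists:
  fixes x y :: "'a::banach_lattice"
  shows "\<exists>m. (\<forall>\<theta>. cos \<theta> *\<^sub>R x + sin \<theta> *\<^sub>R y \<le> m) \<and>
    (\<forall>v. (\<forall>\<theta>. cos \<theta> *\<^sub>R x + sin \<theta> *\<^sub>R y \<le> v) \<longrightarrow> m \<le> v)"
proof -
  define g where "g c = Re c *\<^sub>R x + Im c *\<^sub>R y" for c
  define u where "u = \<bar>x\<bar> + \<bar>y\<bar>"
  have u0: "0 \<le> u" by (simp add: u_def)
  have sc: "r *\<^sub>R w \<le> e *\<^sub>R \<bar>w\<bar>" if "\<bar>r\<bar> \<le> e" for r e and w :: 'a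
  proof -
    have "r *\<^sub>R w \<le> \<bar>r\<bar> *\<^sub>R \<bar>w\<bar>"
    proof (cases "0 \<le> r")
      case True
      thus ?thesis by (simp add: scaleR_left_mono[OF abs_ge_self])
    next
      case False
      hence "(- r) *\<^sub>R (- w) \<le> (- r) *\<^sub>R \<bar>w\<bar>"
        by (intro scaleR_left_mono abs_ge_minus_self) simp
      thus ?thesis using False by simp
    qed
    also have "\<dots> \<le> e *\<^sub>R \<bar>w\<bar>" using that by (intro scaleR_right_mono) auto
    finally show ?thesis .
  qed
  have lip: "g c \<le> g d + e *\<^sub>R u" if "dist d c < e" for c d e
  proof -
    have "\<bar>Re c - Re d\<bar> \<le> e" "\<bar>Im c - Im d\<bar> \<le> e"
      using that abs_Re_le_cmod[of "c - d"] abs_Im_le_cmod[of "c - d"]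
      by (auto simp: dist_norm norm_minus_commute)
    hence "(Re c - Re d) *\<^sub>R x + (Im c - Im d) *\<^sub>R y \<le> e *\<^sub>R \<bar>x\<bar> + e *\<^sub>R \<bar>y\<bar>"
      by (intro add_mono sc)
    thus ?thesis by (simp add: g_def u_def algebra_simps)
  qed
  have "\<exists>F. finite F \<and> F \<noteq> {} \<and> F \<subseteq> sphere 0 1 \<and>
      sphere (0::complex) 1 \<subseteq> (\<Union>d\<in>F. ball d (inverse (real (Suc n))))" for n
  proof -
    obtain F where "F \<subseteq> sphere (0::complex) 1" "finite F"
      "sphere (0::complex) 1 \<subseteq> (\<Union>d\<in>F. ball d (inverse (real (Suc n))))"
    proof (rule compactE_image)
      show "compact (sphere (0::complex) 1)" by (rule compact_sphere)
      show "sphere (0::complex) 1 \<subseteq> (\<Union>d\<in>sphere 0 1. ball d (inverse (real (Suc n))))" by force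
    qed auto
    moreover have "(1::complex) \<in> sphere 0 1" by simp
    ultimately show ?thesis by blast
  qed
  then obtain F where F: "\<And>n. finite (F n)" "\<And>n. F n \<noteq> {}" "\<And>n. F n \<subseteq> sphere 0 1"
      "\<And>n. sphere (0::complex) 1 \<subseteq> (\<Union>d\<in>F n. ball d (inverse (real (Suc n))))"
    by metis
  define s where "s n = Sup_fin (g ` F n)" for n
  have g_le: "g c \<le> s n + inverse (real (Suc n)) *\<^sub>R u" if c: "c \<in> sphere 0 1" for c n
  proof -
    obtain d where d: "d \<in> F n" "dist d c < inverse (real (Suc n))"
      using F(4)[of n] c by (auto simp: subset_iff)
    have "g d \<le> s n" unfolding s_def using F(1) d(1) by (intro Sup_fin.coboundedI) auto
    thus ?thesis using lip[OF d(2)] by (meson add_right_mono order_trans)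
  qed
  have s_le: "s n \<le> v" if "\<And>c. c \<in> sphere 0 1 \<Longrightarrow> g c \<le> v" for n v
    unfolding s_def
  proof (rule Sup_fin.boundedI)
    fix a assume "a \<in> g ` F n"
    then obtain c where "c \<in> F n" "a = g c" by blast
    thus "a \<le> v" using F(3)[of n] that by blast
  qed (use F(1,2) in auto)
  have s_diff: "norm (s m - s n) \<le> inverse (real (Suc N)) * norm u" if "N \<le> m" "N \<le> n" for m n N
  proof -
    have *: "s m - s n \<le> inverse (real (Suc N)) *\<^sub>R u" if "N \<le> n" for m n
    proof -
      have "s m \<le> s n + inverse (real (Suc n)) *\<^sub>R u" using g_le by (rule s_le)
      also have "\<dots> \<le> s n + inverse (real (Suc N)) *\<^sub>R u"
        using that u0 by (intro add_left_mono scaleR_right_mono le_imp_inverse_le) auto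
      finally show ?thesis by (simp add: algebra_simps)
    qed
    have "\<bar>s m - s n\<bar> \<le> inverse (real (Suc N)) *\<^sub>R u"
      using *[OF that(2), of m] *[OF that(1), of n] by (intro abs_leI) auto
    hence "norm \<bar>s m - s n\<bar> \<le> norm (inverse (real (Suc N)) *\<^sub>R u)"
      by (intro norm_mono_nonneg) auto
    thus ?thesis by (simp add: norm_abs_lattice)
  qed
  have inv0: "(\<lambda>n. inverse (real (Suc n))) \<longlonglongrightarrow> 0" by (rule LIMSEQ_inverse_real_of_nat)
  have "Cauchy s"
  proof (rule metric_CauchyI)
    fix e :: real assume "0 < e"
    have "(\<lambda>n. inverse (real (Suc n)) * norm u) \<longlonglongrightarrow> 0"
      using tendsto_mult_left_zero[OF inv0, of "norm u"] .
    from eventually_happens[OF order_tendstoD(2)[OF this \<open>0 < e\<close>]]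
    obtain N where N: "inverse (real (Suc N)) * norm u < e" by auto
    show "\<exists>M. \<forall>m\<ge>M. \<forall>n\<ge>M. dist (s m) (s n) < e"
      using le_less_trans[OF s_diff N] unfolding dist_norm by blast
  qed
  then obtain m where m: "s \<longlonglongrightarrow> m"
    using Cauchy_convergent convergent_def by blast
  have "(\<lambda>n. s n + inverse (real (Suc n)) *\<^sub>R u) \<longlonglongrightarrow> m + 0 *\<^sub>R u"
    by (intro tendsto_intros m inv0)
  hence lim: "(\<lambda>n. s n + inverse (real (Suc n)) *\<^sub>R u) \<longlonglongrightarrow> m" by simp
  have ub: "g c \<le> m" if "c \<in> sphere 0 1" for c
    by (rule lattice_le_LIMSEQ[OF tendsto_const lim]) (use g_le[OF that] in auto)
  have lub: "m \<le> v" if "\<And>c. c \<in> sphere 0 1 \<Longrightarrow> g c \<le> v" for v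
    by (rule lattice_le_LIMSEQ[OF m tendsto_const]) (use s_le[OF that] in auto)
  have cis: "cos \<theta> *\<^sub>R x + sin \<theta> *\<^sub>R y = g (cis \<theta>)" for \<theta> by (simp add: g_def)
  have "\<exists>\<theta>. c = cis \<theta>" if "c \<in> sphere 0 1" for c
    using that rcis_cmod_Arg[of c] by (intro exI[of _ "Arg c"]) (simp add: rcis_def)
  hence "m \<le> v" if "\<forall>\<theta>. g (cis \<theta>) \<le> v" for v
    by (intro lub) (use that in metis)
  moreover have "g (cis \<theta>) \<le> m" for \<theta> by (intro ub) simp
  ultimately show ?thesis unfolding cis by blast
qed

lemma
  shows real_modulus_upper: "cos \<theta> *\<^sub>R re_part z + sin \<theta> *\<^sub>R im_part z \<le> real_modulus z"
    and real_modulus_least: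
      "(\<And>\<theta>. cos \<theta> *\<^sub>R re_part z + sin \<theta> *\<^sub>R im_part z \<le> v) \<Longrightarrow> real_modulus z \<le> v"
proof -
  let ?P = "\<lambda>m. \<forall>\<theta>. cos \<theta> *\<^sub>R re_part z + sin \<theta> *\<^sub>R im_part z \<le> m"
  obtain m where m: "?P m" "\<And>v. ?P v \<Longrightarrow> m \<le> v"
    using real_modulus_exists[of "re_part z" "im_part z"] by blast
  have "real_modulus z = m"
    unfolding real_modulus_def using m by (intro Least_equality) auto
  thus "cos \<theta> *\<^sub>R re_part z + sin \<theta> *\<^sub>R im_part z \<le> real_modulus z"
    and "(\<And>\<theta>. cos \<theta> *\<^sub>R re_part z + sin \<theta> *\<^sub>R im_part z \<le> v) \<Longrightarrow> real_modulus z \<le> v"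
    using m by auto
qed

lemma real_modulus_ge_re: "\<bar>re_part z\<bar> \<le> real_modulus z"
  using real_modulus_upper[of 0 z] real_modulus_upper[of pi z] by (intro abs_leI) auto

lemma real_modulus_ge_im: "\<bar>im_part z\<bar> \<le> real_modulus z"
  using real_modulus_upper[of "pi/2" z] real_modulus_upper[of "- (pi/2)" z]
  by (intro abs_leI) auto

lemma real_modulus_nonneg: "0 \<le> real_modulus z"
  using real_modulus_ge_re[of z] abs_ge_zero order_trans by blast

lemma real_modulus_triangle: "real_modulus (z + w) \<le> real_modulus z + real_modulus w"
proof (rule real_modulus_least)
  fix \<theta>
  show "cos \<theta> *\<^sub>R re_part (z + w) + sin \<theta> *\<^sub>R im_part (z + w) \<le> real_modulus z + real_modulus w"
    using add_mono[OF real_modulus_upper[of \<theta> z] real_modulus_upper[of \<theta> w]]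
    by (simp add: algebra_simps)
qed

lemma real_modulus_scaleC_le: "real_modulus (c *\<^sub>C z) \<le> cmod c *\<^sub>R real_modulus z"
proof (rule real_modulus_least)
  fix \<theta>
  have c: "Re c = cmod c * cos (Arg c)" "Im c = cmod c * sin (Arg c)"
    by (metis Re_rcis rcis_cmod_Arg, metis Im_rcis rcis_cmod_Arg)
  have "cos \<theta> *\<^sub>R re_part (c *\<^sub>C z) + sin \<theta> *\<^sub>R im_part (c *\<^sub>C z) =
      cmod c *\<^sub>R (cos (\<theta> - Arg c) *\<^sub>R re_part z + sin (\<theta> - Arg c) *\<^sub>R im_part z)"
    unfolding scaleC_parts c by (simp add: cos_diff sin_diff algebra_simps)
  also have "\<dots> \<le> cmod c *\<^sub>R real_modulus z"
    by (intro scaleR_left_mono real_modulus_upper) simp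
  finally show "cos \<theta> *\<^sub>R re_part (c *\<^sub>C z) + sin \<theta> *\<^sub>R im_part (c *\<^sub>C z) \<le>
      cmod c *\<^sub>R real_modulus z" .
qed

lemma real_modulus_scaleC: "real_modulus (c *\<^sub>C z) = cmod c *\<^sub>R real_modulus z"
proof (cases "c = 0")
  case True
  have "real_modulus (c *\<^sub>C z) \<le> 0"
    using real_modulus_scaleC_le[of c z] True by simp
  hence "real_modulus (c *\<^sub>C z) = 0" using real_modulus_nonneg by (rule order.antisym)
  thus ?thesis using True by simp
next
  case False
  have "real_modulus (inverse c *\<^sub>C (c *\<^sub>C z)) \<le> cmod (inverse c) *\<^sub>R real_modulus (c *\<^sub>C z)"
    by (rule real_modulus_scaleC_le)
  hence "real_modulus z \<le> inverse (cmod c) *\<^sub>R real_modulus (c *\<^sub>C z)"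
    using False by (simp add: norm_inverse)
  hence "cmod c *\<^sub>R real_modulus z \<le> cmod c *\<^sub>R inverse (cmod c) *\<^sub>R real_modulus (c *\<^sub>C z)"
    by (rule scaleR_left_mono) simp
  thus ?thesis using False by (intro order.antisym real_modulus_scaleC_le) simp
qed

lemma real_modulus_eq_0_iff: "real_modulus z = 0 \<longleftrightarrow> z = 0"
proof
  assume "real_modulus z = 0"
  thus "z = 0"
    using real_modulus_ge_re[of z] real_modulus_ge_im[of z]
    by (simp add: complexification_eq_iff)
next
  assume "z = 0"
  thus "real_modulus z = 0" using real_modulus_scaleC[of 0 z] by simp
qed

text \<open>The modulus, regarded as an element of the complex Banach lattice.\<close>

instantiation complexification :: (banach_lattice) abs
begin

definition "\<bar>z\<bar> = Cplx (real_modulus z) 0"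

instance ..

end

instantiation complexification :: (banach_lattice) real_normed_vector
begin

definition "norm z = norm (real_modulus z)"
definition "dist z w = norm (z - w :: 'a complexification)"
definition "sgn z = z /\<^sub>R norm (z :: 'a complexification)"
definition
  "(uniformity :: ('a complexification \<times> 'a complexification) filter) =
    (INF e\<in>{0 <..}. principal {(z, w). dist z w < e})"
definition
  "open (U :: 'a complexification set) \<longleftrightarrow>
    (\<forall>z\<in>U. eventually (\<lambda>(z', w). z' = z \<longrightarrow> w \<in> U) uniformity)"

instance
proof
  fix z w :: "'a complexification" and r :: real
  show "norm (z + w) \<le> norm z + norm w"
    using norm_mono_nonneg[OF real_modulus_nonneg real_modulus_triangle[of z w]]
      norm_triangle_ineq[of "real_modulus z" "real_modulus w"]
    by (simp add: norm_complexification_def)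
  show "norm (r *\<^sub>R z) = \<bar>r\<bar> * norm z"
    using real_modulus_scaleC[of "complex_of_real r" z]
    by (simp add: norm_complexification_def scaleC_of_real)
qed (simp_all add: norm_complexification_def real_modulus_eq_0_iff dist_complexification_def
    sgn_complexification_def uniformity_complexification_def open_complexification_def)

end

lemma norm_scaleC: "norm (c *\<^sub>C z) = cmod c * norm z"
  by (simp add: norm_complexification_def real_modulus_scaleC)

lemma norm_re_part_le: "norm (re_part z) \<le> norm z"
  unfolding norm_complexification_def
  using norm_mono_nonneg[OF abs_ge_zero real_modulus_ge_re] by (simp add: norm_abs_lattice)

lemma norm_im_part_le: "norm (im_part z) \<le> norm z"
  unfolding norm_complexification_def
  using norm_mono_nonneg[OF abs_ge_zero real_modulus_ge_im] by (simp add: norm_abs_lattice)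

lemma real_modulus_real: "real_modulus (Cplx x 0) = \<bar>x\<bar>"
proof (rule order.antisym)
  show "real_modulus (Cplx x 0) \<le> \<bar>x\<bar>"
  proof (rule real_modulus_least)
    fix \<theta> :: real
    have "cos \<theta> *\<^sub>R x \<le> \<bar>cos \<theta>\<bar> *\<^sub>R \<bar>x\<bar>"
    proof (cases "0 \<le> cos \<theta>")
      case True
      thus ?thesis by (simp add: scaleR_left_mono[OF abs_ge_self])
    next
      case False
      hence "(- cos \<theta>) *\<^sub>R (- x) \<le> (- cos \<theta>) *\<^sub>R \<bar>x\<bar>"
        by (intro scaleR_left_mono abs_ge_minus_self) simp
      thus ?thesis using False by simp
    qed
    also have "\<dots> \<le> 1 *\<^sub>R \<bar>x\<bar>" by (intro scaleR_right_mono) auto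
    finally show "cos \<theta> *\<^sub>R re_part (Cplx x 0) + sin \<theta> *\<^sub>R im_part (Cplx x 0) \<le> \<bar>x\<bar>" by simp
  qed
  show "\<bar>x\<bar> \<le> real_modulus (Cplx x 0)" using real_modulus_ge_re[of "Cplx x 0"] by simp
qed

lemma norm_complexification_le: "norm z \<le> norm (re_part z) + norm (im_part z)"
proof -
  have "z = Cplx (re_part z) 0 + \<i> *\<^sub>C Cplx (im_part z) 0"
    by (simp add: complexification_eq_iff)
  hence "norm z \<le> norm (Cplx (re_part z) 0) + norm (\<i> *\<^sub>C Cplx (im_part z) 0)"
    by (metis norm_triangle_ineq)
  thus ?thesis
    unfolding norm_scaleC by (simp add: norm_complexification_def real_modulus_real norm_abs_lattice)
qed

instance complexification :: (banach_lattice) banach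
proof
  fix X :: "nat \<Rightarrow> 'a complexification"
  assume X: "Cauchy X"
  have *: "dist (re_part z) (re_part w) \<le> dist z w" "dist (im_part z) (im_part w) \<le> dist z w"
    for z w :: "'a complexification"
    using norm_re_part_le[of "z - w"] norm_im_part_le[of "z - w"] by (simp_all add: dist_norm)
  have "Cauchy (\<lambda>n. re_part (X n))" "Cauchy (\<lambda>n. im_part (X n))"
    using X unfolding Cauchy_def by (blast intro: le_less_trans[OF *(1)] le_less_trans[OF *(2)])+
  then obtain x y where xy: "(\<lambda>n. re_part (X n)) \<longlonglongrightarrow> x" "(\<lambda>n. im_part (X n)) \<longlonglongrightarrow> y"
    unfolding Cauchy_convergent_iff convergent_def by blast
  have "(\<lambda>n. norm (re_part (X n) - x) + norm (im_part (X n) - y)) \<longlonglongrightarrow> 0"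
    using tendsto_add[OF tendsto_norm_zero[OF LIM_zero[OF xy(1)]] tendsto_norm_zero[OF LIM_zero[OF xy(2)]]]
    by simp
  hence "(\<lambda>n. X n - Cplx x y) \<longlonglongrightarrow> 0"
    by (rule Lim_null_comparison[rotated])
      (use norm_complexification_le[of "X _ - Cplx x y"] in auto)
  hence "X \<longlonglongrightarrow> Cplx x y" by (rule LIM_zero_cancel)
  thus "convergent X" by (auto simp: convergent_def)
qed


section \<open>Operators on complex Banach lattices\<close>

definition principal_ideal ::
    "'a::banach_lattice complexification \<Rightarrow> 'a complexification set"
  where "principal_ideal u = {f. \<exists>c\<ge>0. \<bar>f\<bar> \<le> c *\<^sub>R u}"

definition linear_operator ::
    "('a::real_vector complexification \<Rightarrow> 'a complexification) \<Rightarrow> bool"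
  where "linear_operator T \<longleftrightarrow> Vector_Spaces.linear scaleC scaleC T"

definition positive_operator ::
    "('a::ordered_real_vector complexification \<Rightarrow> 'a complexification) \<Rightarrow> bool"
  where "positive_operator T \<longleftrightarrow> T ` {f. 0 \<le> f} \<subseteq> {f. 0 \<le> f}"

definition dual_space :: "('a::banach_lattice complexification \<Rightarrow> complex) set"
  where "dual_space = {\<phi>. Vector_Spaces.linear scaleC (*) \<phi> \<and> continuous_on UNIV \<phi>}"

definition weak_topology :: "'a::banach_lattice complexification topology"
  where "weak_topology = topology_generated_by {\<phi> -` U |\<phi> U. \<phi> \<in> dual_space \<and> open U}"

definition relatively_compact_in :: "'a topology \<Rightarrow> 'a set \<Rightarrow> bool"
  where "relatively_compact_in X S \<longleftrightarrow> S \<subseteq> topspace X \<and> compactin X (X closure_of S)"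

definition weakly_almost_periodic ::
    "('a::banach_lattice complexification \<Rightarrow> 'a complexification) \<Rightarrow> bool"
  where "weakly_almost_periodic T \<longleftrightarrow>
    (\<forall>f. relatively_compact_in weak_topology (range (\<lambda>n. (T ^^ n) f)))"

definition point_spectrum ::
    "('a::real_vector complexification \<Rightarrow> 'a complexification) \<Rightarrow> complex set"
  where "point_spectrum T = {\<mu>. \<exists>f. f \<noteq> 0 \<and> T f = \<mu> *\<^sub>C f}"

end

theory Submission
  imports Defs
begin

text \<open>
  Suppose that \<open>T z = \<mu> *\<^sub>C z\<close> with \<open>cmod \<mu> = 1\<close>, \<open>\<mu> \<noteq> 1\<close> and \<open>z \<noteq> 0\<close>, and let \<open>v\<close> be the modulus of \<open>z\<close>.
  A positive operator \<open>T\<close> is the complexification of a positive operator \<open>R\<close> on the real part, so that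
  everything happens in the real Banach lattice. Positivity gives \<open>v \<le> R v\<close>, and weak almost periodicity
  gives bounded powers (\<open>weakly_almost_periodic_power_bounded\<close>). These two facts yield, by the
  Hahn--Banach theorem, a positive continuous functional \<open>\<phi>\<close> with \<open>\<phi> (R x) = \<phi> x\<close> and \<open>\<phi> v > 0\<close>
  (\<open>invariant_positive_functional\<close>).

  It is best to compute modulo the elements \<open>x\<close> with \<open>\<phi> \<bar>x\<bar> = 0\<close>. There \<open>R v = v\<close>, and on the plane of the
  elements \<open>X c\<close>, the real parts of \<open>c *\<^sub>C z\<close>, the operator acts by the rotation \<open>R (X c) = X (c * \<mu>)\<close>.
  Consequently \<open>R\<close> maps \<open>g c = pprt (X c - \<kappa> *\<^sub>R v)\<close> to something that is at least \<open>g (c * \<mu>)\<close>. Equality holds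
  because \<open>\<phi>\<close> would register any loss, while the powers of \<open>\<mu>\<close> return arbitrarily close to \<open>1\<close>.
  Intuitively, \<open>g c\<close> lives where the argument of \<open>z\<close> is close to \<open>- Arg c\<close>. For
  \<open>\<kappa> = cmod (1 + \<mu>) / 2 < 1\<close> the elements \<open>g c\<close> and \<open>g (c * \<mu>)\<close> are disjoint, since
  \<open>X c + X (c * \<mu>) = X (c * (1 + \<mu>)) \<le> (2 * \<kappa>) *\<^sub>R v\<close>.

  The hypothesis on closed principal ideals says that some \<open>(R ^^ n) (g c)\<close> is approximated by elements
  dominated by multiples of its successor \<open>(R ^^ Suc n) (g c)\<close>, from which it is disjoint as far as
  \<open>\<phi>\<close> can tell. Hence \<open>\<phi> (g c) = 0\<close> for all unimodular \<open>c\<close>. As \<open>v\<close> is the supremum of the \<open>X c\<close>, and finitely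
  many of them suffice up to a small multiple of \<open>v\<close>, this forces \<open>\<phi> v \<le> (\<kappa> + \<epsilon>) * \<phi> v\<close> with
  \<open>\<kappa> + \<epsilon> < 1\<close>, a contradiction (\<open>no_nontrivial_rotation\<close>).
\<close>


section \<open>Sublinear functionals and the Hahn--Banach theorem\<close>

text \<open>Homogeneity is only required for positive factors. The value at \<open>0\<close> is then forced to
  vanish, since \<open>p 0 = 2 * p 0\<close>.\<close>

definition sublinear :: "('a::real_vector \<Rightarrow> real) \<Rightarrow> bool"
  where "sublinear p \<longleftrightarrow>
    (\<forall>x y. p (x + y) \<le> p x + p y) \<and> (\<forall>c x. 0 < c \<longrightarrow> p (c *\<^sub>R x) = c * p x)"

lemma sublinear_zero: "sublinear p \<Longrightarrow> p 0 = 0"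
proof -
  assume "sublinear p"
  hence "p (2 *\<^sub>R 0) = 2 * p 0" unfolding sublinear_def by (metis zero_less_numeral)
  thus ?thesis by simp
qed

lemma sublinear_add: "sublinear p \<Longrightarrow> p (x + y) \<le> p x + p y"
  by (simp add: sublinear_def)

lemma sublinear_scale: "sublinear p \<Longrightarrow> 0 \<le> c \<Longrightarrow> p (c *\<^sub>R x) = c * p x"
  by (cases "c = 0") (auto simp: sublinear_zero sublinear_def)

lemma sublinear_minus: "sublinear p \<Longrightarrow> - p (- x) \<le> p x"
  using sublinear_add[of p x "- x"] by (simp add: sublinear_zero)

text \<open>Three sublinear functionals below are infima of simpler functions: the lower bound of a
  chain in Zorn's lemma, the functional that forces a prescribed value at a point, and the
  functional that forces invariance under an operator.\<close>

lemma sublinear_INF: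
  fixes h :: "'i \<Rightarrow> 'a::real_vector \<Rightarrow> real"
  assumes I: "I \<noteq> {}" and bdd: "\<And>x. bdd_below ((\<lambda>i. h i x) ` I)"
    and add: "\<And>i j x y. i \<in> I \<Longrightarrow> j \<in> I \<Longrightarrow> \<exists>k\<in>I. h k (x + y) \<le> h i x + h j y"
    and scale: "\<And>i c x. i \<in> I \<Longrightarrow> 0 < c \<Longrightarrow> \<exists>k\<in>I. h k (c *\<^sub>R x) \<le> c * h i x"
  shows "sublinear (\<lambda>x. INF i\<in>I. h i x)"
proof -
  define q where "q x = (INF i\<in>I. h i x)" for x
  have low: "q x \<le> h i x" if "i \<in> I" for i x
    unfolding q_def using bdd that by (rule cINF_lower)
  have great: "r \<le> q x" if "\<And>i. i \<in> I \<Longrightarrow> r \<le> h i x" for r x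
    unfolding q_def using I that by (rule cINF_greatest)
  have "q (x + y) \<le> q x + q y" for x y
  proof -
    have "q (x + y) - h i x \<le> h j y" if "i \<in> I" "j \<in> I" for i j
      using add[OF that, of x y] low[of _ "x + y"] by force
    hence "q (x + y) - h i x \<le> q y" if "i \<in> I" for i
      using that great by blast
    hence "q (x + y) - q y \<le> h i x" if "i \<in> I" for i
      using that by (simp add: algebra_simps)
    hence "q (x + y) - q y \<le> q x" by (rule great)
    thus ?thesis by simp
  qed
  moreover have scale_le: "q (c *\<^sub>R x) \<le> c * q x" if c: "0 < c" for c x
  proof -
    have "q (c *\<^sub>R x) / c \<le> h i x" if "i \<in> I" for i
      using scale[OF that c, of x] low[of _ "c *\<^sub>R x"] c by (force simp: field_simps)
    hence "q (c *\<^sub>R x) / c \<le> q x" by (rule great)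
    thus ?thesis using c by (simp add: field_simps)
  qed
  moreover have "c * q x \<le> q (c *\<^sub>R x)" if c: "0 < c" for c x
    using scale_le[of "inverse c" "c *\<^sub>R x"] c by (simp add: field_simps)
  ultimately have "sublinear q"
    unfolding sublinear_def by (simp add: order.antisym)
  thus ?thesis unfolding q_def[abs_def] .
qed

text \<open>Lowering \<open>p\<close> so that it becomes odd at \<open>z\<close>: the choice \<open>t = 1\<close> in the infimum gives
  \<open>q (- z) \<le> p 0 - p z\<close>, whereas sublinearity of \<open>p\<close> keeps the infimum finite.\<close>

lemma sublinear_directional:
  fixes p :: "'a::real_vector \<Rightarrow> real"
  assumes p: "sublinear p"
  obtains q where "sublinear q" "\<And>x. q x \<le> p x" "q (- z) \<le> - p z"
proof -
  define h where "h t x = p (x + t *\<^sub>R z) - t * p z" for t x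
  have bdd: "bdd_below ((\<lambda>t. h t x) ` {0..})" for x
  proof (rule bdd_belowI2)
    fix t :: real assume "t \<in> {0..}"
    thus "- p (- x) \<le> h t x"
      using sublinear_add[OF p, of "x + t *\<^sub>R z" "- x"] sublinear_scale[OF p, of t z]
      by (simp add: h_def)
  qed
  have sub: "sublinear (\<lambda>x. INF t\<in>{0..}. h t x)"
  proof (rule sublinear_INF[OF _ bdd])
    fix s t :: real and x y assume "s \<in> {0..}" "t \<in> {0..}"
    moreover have "h (s + t) (x + y) \<le> h s x + h t y"
      using sublinear_add[OF p, of "x + s *\<^sub>R z" "y + t *\<^sub>R z"]
      by (simp add: h_def algebra_simps)
    ultimately show "\<exists>k\<in>{0..}. h k (x + y) \<le> h s x + h t y"
      by (intro bexI[of _ "s + t"]) auto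
  next
    fix t c :: real and x assume "t \<in> {0..}" "0 < c"
    moreover from \<open>0 < c\<close> have "h (c * t) (c *\<^sub>R x) \<le> c * h t x"
      using sublinear_scale[OF p, of c "x + t *\<^sub>R z"] by (simp add: h_def algebra_simps)
    ultimately show "\<exists>k\<in>{0..}. h k (c *\<^sub>R x) \<le> c * h t x"
      by (intro bexI[of _ "c * t"]) auto
  qed simp
  have low: "(INF t\<in>{0..}. h t x) \<le> h t x" if "0 \<le> t" for t x
    using that by (intro cINF_lower[OF bdd]) simp
  show thesis
  proof (rule that[OF sub])
    show "(INF t\<in>{0..}. h t x) \<le> p x" for x
      using low[of 0 x] by (simp add: h_def)
    show "(INF t\<in>{0..}. h t (- z)) \<le> - p z"
      using low[of 1 "- z"] by (simp add: h_def sublinear_zero[OF p])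
  qed
qed

text \<open>Linear functionals are exactly the minimal sublinear ones, because a sublinear functional
  that is not odd at some point can be lowered. Hence Zorn's lemma yields the Hahn--Banach theorem
  without extending a functional from subspace to subspace.\<close>

theorem Hahn_Banach_sublinear:
  fixes p :: "'a::real_vector \<Rightarrow> real"
  assumes p: "sublinear p"
  obtains \<phi> where "linear \<phi>" "\<And>x. \<phi> x \<le> p x" "\<phi> z = p z"
proof -
  \<comment> \<open>Starting from a functional that is odd at \<open>z\<close> secures the value there.\<close>
  obtain p' where p': "sublinear p'" "\<And>x. p' x \<le> p x" "p' (- z) \<le> - p z"
    by (rule sublinear_directional[OF p, of z]) blast
  define A where "A = {q. sublinear q \<and> (\<forall>x. q x \<le> p' x)}"
  define P where "P q r \<longleftrightarrow> (\<forall>x. r x \<le> q x)" for q r :: "'a \<Rightarrow> real"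
  have "\<exists>m\<in>A. \<forall>a\<in>A. P m a \<longrightarrow> a = m"
  proof (rule predicate_Zorn)
    show "partial_order_on A (relation_of P A)"
      by (rule partial_order_on_relation_ofI)
        (auto simp: P_def fun_eq_iff intro: order_trans order.antisym)
  next
    fix C assume C: "C \<in> Chains (relation_of P A)"
    have CA: "q \<in> A" if "q \<in> C" for q
      using C that by (auto simp: Chains_def relation_of_def)
    have Cc: "P q r \<or> P r q" if "q \<in> C" "r \<in> C" for q r
      using C that by (auto simp: Chains_def relation_of_def)
    show "\<exists>u\<in>A. \<forall>a\<in>C. P a u"
    proof (cases "C = {}")
      case True
      thus ?thesis using p'(1) by (auto simp: A_def)
    next
      case False
      define u where "u x = (INF q\<in>C. q x)" for x
      have bdd: "bdd_below ((\<lambda>q. q x) ` C)" for x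
      proof (rule bdd_belowI2)
        fix q assume "q \<in> C"
        hence "sublinear q" "q (- x) \<le> p' (- x)" using CA by (auto simp: A_def)
        thus "- p' (- x) \<le> q x" using sublinear_minus[of q x] by simp
      qed
      have low: "u x \<le> q x" if "q \<in> C" for q x
        unfolding u_def using that by (intro cINF_lower[OF bdd])
      have "sublinear (\<lambda>x. INF q\<in>C. q x)"
      proof (rule sublinear_INF[OF False bdd])
        fix q r x y assume qr: "q \<in> C" "r \<in> C"
        have sl: "sublinear q" "sublinear r" using qr CA by (auto simp: A_def)
        show "\<exists>k\<in>C. k (x + y) \<le> q x + r y"
        proof (cases "P q r")
          case True
          hence "r (x + y) \<le> q x + r y"
            using sublinear_add[OF sl(2), of x y] unfolding P_def
            by (meson add_right_mono order_trans)
          thus ?thesis using qr by blast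
        next
          case False
          hence "P r q" using Cc qr by blast
          hence "q (x + y) \<le> q x + r y"
            using sublinear_add[OF sl(1), of x y] unfolding P_def
            by (meson add_left_mono order_trans)
          thus ?thesis using qr by blast
        qed
      next
        fix q c x assume "q \<in> C" "0 < (c::real)"
        moreover from \<open>q \<in> C\<close> have "sublinear q" using CA by (auto simp: A_def)
        ultimately show "\<exists>k\<in>C. k (c *\<^sub>R x) \<le> c * q x"
          by (intro bexI[of _ q]) (simp_all add: sublinear_scale)
      qed
      hence "sublinear u" unfolding u_def[abs_def] .
      moreover obtain q where "q \<in> C" using False by blast
      hence "u x \<le> p' x" for x
        using low[of q x] CA[of q] by (force simp: A_def intro: order_trans)
      ultimately show ?thesis
        using low by (intro bexI[of _ u]) (auto simp: A_def P_def)
    qed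
  qed
  then obtain m where mA: "m \<in> A" and max: "\<And>q. q \<in> A \<Longrightarrow> P m q \<Longrightarrow> q = m"
    by blast
  have m: "sublinear m" "m x \<le> p' x" for x using mA by (auto simp: A_def)
  have min: "q = m" if "sublinear q" "\<And>x. q x \<le> m x" for q
    using that m(2) by (intro max) (auto simp: A_def P_def intro: order_trans)
  have odd: "m (- x) = - m x" for x
  proof -
    obtain q where "sublinear q" "\<And>y. q y \<le> m y" "q (- x) \<le> - m x"
      by (rule sublinear_directional[OF m(1), of x]) blast
    hence "m (- x) \<le> - m x" using min by metis
    thus ?thesis using sublinear_minus[OF m(1), of x] by simp
  qed
  have "linear m"
  proof (rule linearI)
    show "m (x + y) = m x + m y" for x y
      using sublinear_add[OF m(1), of x y] sublinear_add[OF m(1), of "- x" "- y"]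
      unfolding minus_add_distrib[symmetric] odd by simp
    show "m (c *\<^sub>R x) = c *\<^sub>R m x" for c x
    proof (cases "0 \<le> c")
      case False
      thus ?thesis using sublinear_scale[OF m(1), of "- c" x] by (simp add: odd)
    qed (simp add: sublinear_scale[OF m(1)])
  qed
  moreover have le: "m x \<le> p x" for x using m(2) p'(2) order_trans by blast
  moreover have "m z = p z"
    using le[of z] m(2)[of "- z"] p'(3) by (simp add: odd)
  ultimately show thesis by (rule that)
qed


section \<open>Positive functionals and positive operators on Banach lattices\<close>

lemma norm_pprt_le: "norm (pprt x) \<le> norm (x :: 'a::banach_lattice)"
  by (rule norm_mono_abs) (simp add: pprt_def abs_ge_self)

lemma pprt_add_le: "pprt (x + y) \<le> pprt x + pprt (y :: 'a::banach_lattice)"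
  by (simp add: pprt_def add_mono add_nonneg_nonneg)

lemma pprt_scaleR:
  fixes x :: "'a::banach_lattice"
  assumes c: "0 < c"
  shows "pprt (c *\<^sub>R x) = c *\<^sub>R pprt x"
proof (rule order.antisym)
  have le: "pprt (d *\<^sub>R y) \<le> d *\<^sub>R pprt y" if "0 < d" for d and y :: 'a
    using that unfolding pprt_def[of "d *\<^sub>R y"]
    by (simp add: scaleR_left_mono scaleR_nonneg_nonneg pprt_def)
  show "pprt (c *\<^sub>R x) \<le> c *\<^sub>R pprt x" by (rule le[OF c])
  have "c *\<^sub>R pprt (inverse c *\<^sub>R (c *\<^sub>R x)) \<le> c *\<^sub>R (inverse c *\<^sub>R pprt (c *\<^sub>R x))"
    using c by (intro scaleR_left_mono le) auto
  thus "c *\<^sub>R pprt x \<le> pprt (c *\<^sub>R x)" using c by simp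
qed

lemma sublinear_norm_pprt: "sublinear (\<lambda>x::'a::banach_lattice. norm (pprt x))"
  unfolding sublinear_def
proof (intro conjI allI impI)
  fix x y :: 'a
  show "norm (pprt (x + y)) \<le> norm (pprt x) + norm (pprt y)"
    using norm_mono_nonneg[OF zero_le_pprt pprt_add_le[of x y]] norm_triangle_ineq order_trans
    by blast
qed (simp add: pprt_scaleR)

lemma linear_mono:
  fixes f :: "'a::banach_lattice \<Rightarrow> 'b::banach_lattice"
  assumes "linear f" "\<And>x. 0 \<le> x \<Longrightarrow> 0 \<le> f x" "x \<le> y"
  shows "f x \<le> f y"
  using assms(2)[of "y - x"] assms(3) by (simp add: linear_diff[OF assms(1)])

text \<open>Domination by the norm of the positive part packs positivity and contractivity of a functional
  into a single sublinear bound, the form in which the Hahn--Banach theorem delivers it.\<close>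

lemma dominated_functional:
  fixes \<phi> :: "'a::banach_lattice \<Rightarrow> real"
  assumes \<phi>: "linear \<phi>" "\<And>x. \<phi> x \<le> norm (pprt x)"
  shows dominated_functional_nonneg: "0 \<le> x \<Longrightarrow> 0 \<le> \<phi> x"
    and dominated_functional_abs: "\<bar>\<phi> x\<bar> \<le> norm x"
proof -
  show "0 \<le> \<phi> x" if "0 \<le> x"
    using \<phi>(2)[of "- x"] that by (simp add: linear_neg[OF \<phi>(1)])
  have "\<phi> y \<le> norm y" for y using \<phi>(2)[of y] norm_pprt_le[of y] by simp
  from this[of x] this[of "- x"] show "\<bar>\<phi> x\<bar> \<le> norm x"
    by (simp add: linear_neg[OF \<phi>(1)])
qed

lemma linear_funpow:
  fixes R :: "'a::real_vector \<Rightarrow> 'a"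
  assumes "linear R"
  shows "linear (R ^^ n)"
proof (induction n)
  case (Suc n)
  thus ?case using linear_compose[OF Suc assms] by (simp add: o_def)
qed (simp add: linearI)

lemma funpow_nonneg:
  fixes R :: "'a::ordered_real_vector \<Rightarrow> 'a"
  assumes "\<And>x. 0 \<le> x \<Longrightarrow> 0 \<le> R x" "0 \<le> x"
  shows "0 \<le> (R ^^ n) x"
  by (induction n) (auto simp: assms)

lemma abs_positive_le:
  fixes f :: "'a::banach_lattice \<Rightarrow> 'a"
  assumes "linear f" "\<And>x. 0 \<le> x \<Longrightarrow> 0 \<le> f x"
  shows "\<bar>f x\<bar> \<le> f \<bar>x\<bar>"
  using linear_mono[OF assms abs_ge_self[of x]] linear_mono[OF assms abs_ge_minus_self[of x]]
  by (intro abs_leI) (simp_all add: linear_neg[OF assms(1)])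

lemma term_le_suminf:
  fixes f :: "nat \<Rightarrow> 'a::banach_lattice"
  assumes "summable f" "\<And>n. 0 \<le> f n"
  shows "f k \<le> suminf f"
proof (rule lattice_le_LIMSEQ[OF tendsto_const])
  show "(\<lambda>n. sum f {..<n + Suc k}) \<longlonglongrightarrow> suminf f"
    using summable_LIMSEQ[OF assms(1)] by (rule LIMSEQ_ignore_initial_segment)
  show "f k \<le> sum f {..<n + Suc k}" for n
    using sum_mono2[of "{..<n + Suc k}" "{k}" f] assms(2) by simp
qed

text \<open>A gliding hump: if the powers are unbounded, a geometric series of nearly norming vectors has an
  orbit with norms at least \<open>4 ^ k\<close>, and a geometric series of functionals norming these orbit
  elements is unbounded along the orbit. Positivity makes each series dominate its terms, so
  nothing cancels.\<close>

lemma positive_power_bounded: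
  fixes R :: "'a::banach_lattice \<Rightarrow> 'a"
  assumes lin: "linear R" and pos: "\<And>x. 0 \<le> x \<Longrightarrow> 0 \<le> R x"
    and bdd: "\<And>x \<psi>. bounded_linear \<psi> \<Longrightarrow> \<exists>B. \<forall>n. \<psi> ((R ^^ n) x) \<le> (B::real)"
  shows "\<exists>M. \<forall>n x. norm ((R ^^ n) x) \<le> M * norm x"
proof (rule ccontr)
  assume neg: "\<not> ?thesis"
  note linn = linear_funpow[OF lin]
  have posn: "0 \<le> (R ^^ n) x" if "0 \<le> x" for n x using that by (intro funpow_nonneg pos)
  have "\<exists>n x. 0 \<le> x \<and> norm x \<le> 1 \<and> 8 ^ k \<le> norm ((R ^^ n) x)" for k :: nat
  proof -
    obtain n x where x: "8 ^ k * norm x < norm ((R ^^ n) x)"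
      using neg by (meson not_le)
    have "x \<noteq> 0" using x linear_0[OF linn] by auto
    have "norm ((R ^^ n) x) \<le> norm ((R ^^ n) \<bar>x\<bar>)"
      using norm_mono_abs[of "(R ^^ n) x" "(R ^^ n) \<bar>x\<bar>"]
        abs_positive_le[of "R ^^ n", OF linn posn] posn[of "\<bar>x\<bar>" n] by simp
    hence "8 ^ k * norm x \<le> norm ((R ^^ n) \<bar>x\<bar>)" using x by simp
    hence "8 ^ k \<le> norm ((R ^^ n) (inverse (norm x) *\<^sub>R \<bar>x\<bar>))"
      using \<open>x \<noteq> 0\<close> by (simp add: linear_scale[OF linn] field_simps)
    moreover have "0 \<le> inverse (norm x) *\<^sub>R \<bar>x\<bar>" "norm (inverse (norm x) *\<^sub>R \<bar>x\<bar>) \<le> 1"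
      using \<open>x \<noteq> 0\<close> by (simp_all add: scaleR_nonneg_nonneg norm_abs_lattice)
    ultimately show ?thesis by blast
  qed
  then obtain n x where x: "\<And>k. 0 \<le> x k" "\<And>k. norm (x k) \<le> 1"
      "\<And>k. 8 ^ k \<le> norm ((R ^^ n k) (x k))"
    by metis
  define y where "y k = (R ^^ n k) (x k)" for k
  have y0: "0 \<le> y k" for k by (simp add: y_def posn x(1))
  have "\<exists>\<phi>. linear \<phi> \<and> (\<forall>x. \<phi> x \<le> norm (pprt x)) \<and> \<phi> (y k) = norm (pprt (y k))" for k
    using Hahn_Banach_sublinear[OF sublinear_norm_pprt] by metis
  then obtain \<phi> where \<phi>: "\<And>k. linear (\<phi> k)" "\<And>k x. \<phi> k x \<le> norm (pprt x)"
      "\<And>k. \<phi> k (y k) = norm (y k)"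
    using y0 by (metis pprt_eq_id)
  note \<phi>nn = dominated_functional_nonneg[OF \<phi>(1,2)]
    and \<phi>abs = dominated_functional_abs[OF \<phi>(1,2)]
  have geo: "summable (\<lambda>k. (1/2::real) ^ k * c)" for c
    by (intro summable_mult2 summable_geometric) simp
  define s where "s = (\<Sum>k. (1/2) ^ k *\<^sub>R x k)"
  have "summable (\<lambda>k. (1/2) ^ k *\<^sub>R x k)"
    by (rule summable_comparison_test'[OF geo[of 1], of 0])
      (use x(2) in \<open>simp add: mult_left_le\<close>)
  hence s: "(1/2) ^ k *\<^sub>R x k \<le> s" for k
    unfolding s_def by (rule term_le_suminf) (simp add: x(1) scaleR_nonneg_nonneg)
  define \<psi> where "\<psi> z = (\<Sum>k. (1/2) ^ k * \<phi> k z)" for z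
  have sm: "summable (\<lambda>k. (1/2) ^ k * \<phi> k z)" for z
    by (rule summable_comparison_test'[OF geo[of "norm z"], of 0])
      (use \<phi>abs in \<open>simp add: abs_mult\<close>)
  have "bounded_linear \<psi>"
  proof (rule bounded_linear_intro)
    show "\<psi> (u + v) = \<psi> u + \<psi> v" for u v
      using suminf_add[OF sm[of u] sm[of v]]
      by (simp add: \<psi>_def linear_add[OF \<phi>(1)] algebra_simps)
    show "\<psi> (r *\<^sub>R u) = r *\<^sub>R \<psi> u" for r u
      using suminf_mult[OF sm[of u], of r]
      by (simp add: \<psi>_def linear_scale[OF \<phi>(1)] algebra_simps)
    show "norm (\<psi> u) \<le> norm u * 2" for u
    proof -
      have "norm (\<psi> u) \<le> (\<Sum>k. (1/2) ^ k * norm u)"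
        unfolding \<psi>_def
        by (rule norm_suminf_le[OF _ geo]) (use \<phi>abs in \<open>simp add: abs_mult\<close>)
      also have "\<dots> = 2 * norm u"
        using suminf_mult2[OF summable_geometric[of "1/2::real"], of "norm u"]
          suminf_geometric[of "1/2::real"] by simp
      finally show ?thesis by simp
    qed
  qed
  then obtain B where B: "\<And>m. \<psi> ((R ^^ m) s) \<le> B" using bdd by blast
  have "2 ^ k \<le> B" for k
  proof -
    have Rs: "0 \<le> (R ^^ m) s" for m
      using order_trans[OF x(1)[of 0] s[of 0, simplified]] by (rule posn)
    have "(2::real) ^ k = (1/2) ^ k * ((1/2) ^ k * 8 ^ k)"
      by (simp flip: power_mult_distrib)
    also have "\<dots> \<le> (1/2) ^ k * ((1/2) ^ k * \<phi> k (y k))"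
      unfolding \<phi>(3) unfolding y_def by (intro mult_left_mono x(3)) simp_all
    also have "\<dots> = (1/2) ^ k * \<phi> k ((R ^^ n k) ((1/2) ^ k *\<^sub>R x k))"
      by (simp add: y_def linear_scale[OF linn] linear_scale[OF \<phi>(1)])
    also have "\<dots> \<le> (1/2) ^ k * \<phi> k ((R ^^ n k) s)"
      by (intro mult_left_mono linear_mono[OF \<phi>(1) \<phi>nn] linear_mono[of "R ^^ n k", OF linn posn] s)
        auto
    also have "\<dots> \<le> \<psi> ((R ^^ n k) s)"
      unfolding \<psi>_def by (rule term_le_suminf[OF sm]) (simp add: \<phi>nn Rs)
    also have "\<dots> \<le> B" by (rule B)
    finally show ?thesis .
  qed
  moreover obtain k where "B < 2 ^ k" using real_arch_pow[of 2 B] by auto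
  ultimately show False by (metis not_le)
qed

lemma funpow_ge:
  fixes R :: "'a::banach_lattice \<Rightarrow> 'a"
  assumes "linear R" "\<And>x. 0 \<le> x \<Longrightarrow> 0 \<le> R x" "v \<le> R v"
  shows "v \<le> (R ^^ n) v"
proof (induction n)
  case (Suc n)
  show ?case using linear_mono[OF assms(1,2) Suc] assms(3) by simp
qed simp

text \<open>The Hahn--Banach theorem is applied to the distance-like sublinear functional obtained by
  minimising \<open>norm (pprt (x + y - R y))\<close> over \<open>y\<close>. It is nonpositive on the range of \<open>id - R\<close>, which
  makes every linear functional below it invariant. At \<open>v\<close> it is positive: summing the first \<open>N\<close>
  powers of \<open>R\<close> turns \<open>y - R y\<close> into the bounded telescope \<open>y - (R ^^ N) y\<close>, whereas the
  contributions of \<open>v \<le> (R ^^ i) v\<close> add up to at least \<open>N *\<^sub>R v\<close>.\<close>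

lemma invariant_positive_functional:
  fixes R :: "'a::banach_lattice \<Rightarrow> 'a"
  assumes lin: "linear R" and pos: "\<And>x. 0 \<le> x \<Longrightarrow> 0 \<le> R x"
    and M: "\<And>n x. norm ((R ^^ n) x) \<le> M * norm x"
    and v: "0 \<le> v" "v \<noteq> 0" "v \<le> R v"
  obtains \<phi> where "linear \<phi>" "\<And>x. \<phi> x \<le> norm (pprt x)" "\<And>x. \<phi> (R x) = \<phi> x" "0 < \<phi> v"
proof -
  note linn = linear_funpow[OF lin]
  have posn: "0 \<le> (R ^^ n) x" if "0 \<le> x" for n x using that by (intro funpow_nonneg pos)
  define h where "h y x = norm (pprt (x + y - R y))" for y x
  define p where "p x = (INF y. h y x)" for x
  have bdd: "bdd_below (range (\<lambda>y. h y x))" for x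
    by (rule bdd_belowI2[of _ 0]) (simp add: h_def)
  have low: "p x \<le> h y x" for x y
    unfolding p_def using bdd by (rule cINF_lower) simp
  have "sublinear (\<lambda>x. INF y. h y x)"
  proof (rule sublinear_INF[OF _ bdd])
    fix y1 y2 x1 x2
    have "h (y1 + y2) (x1 + x2) \<le> h y1 x1 + h y2 x2"
      using sublinear_add[OF sublinear_norm_pprt, of "x1 + y1 - R y1" "x2 + y2 - R y2"]
      by (simp add: h_def linear_add[OF lin] algebra_simps)
    thus "\<exists>k\<in>UNIV. h k (x1 + x2) \<le> h y1 x1 + h y2 x2" by blast
  next
    fix y x and c :: real assume "0 < c"
    hence "h (c *\<^sub>R y) (c *\<^sub>R x) = c * h y x"
      using sublinear_scale[OF sublinear_norm_pprt, of c "x + y - R y"]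
      by (simp add: h_def linear_scale[OF lin] algebra_simps)
    thus "\<exists>k\<in>UNIV. h k (c *\<^sub>R x) \<le> c * h y x" by (metis UNIV_I order_refl)
  qed simp
  hence sub: "sublinear p" by (simp add: p_def[abs_def])
  have telescope: "(\<Sum>i<N. (R ^^ i) (y - R y)) = y - (R ^^ N) y" for N y
    by (induction N) (simp_all add: linear_diff[OF linn] funpow_swap1)
  have norm_v: "norm v \<le> M * h y v" for y
  proof -
    define w where "w = pprt (v + y - R y)"
    have main: "real N * norm v \<le> real N * (M * norm w) + (M + 1) * norm y" for N :: nat
    proof -
      have "(\<Sum>i<N. (R ^^ i) v) + (y - (R ^^ N) y) = (\<Sum>i<N. (R ^^ i) (v + y - R y))"
        unfolding telescope[symmetric] sum.distrib[symmetric]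
        by (simp add: linear_add[OF linn, symmetric] add_diff_eq)
      also have "\<dots> \<le> (\<Sum>i<N. (R ^^ i) w)"
        by (intro sum_mono linear_mono[OF linn posn]) (simp_all add: w_def pprt_def)
      finally have "(\<Sum>i<N. (R ^^ i) v) \<le> (\<Sum>i<N. (R ^^ i) w) + ((R ^^ N) y - y)"
        by (simp add: algebra_simps)
      moreover have "real N *\<^sub>R v \<le> (\<Sum>i<N. (R ^^ i) v)"
        using sum_mono[of "{..<N}" "\<lambda>_. v" "\<lambda>i. (R ^^ i) v"] funpow_ge[OF lin pos v(3)]
        by (simp add: sum_constant_scaleR)
      ultimately have "real N *\<^sub>R v \<le> (\<Sum>i<N. (R ^^ i) w) + ((R ^^ N) y - y)" by simp
      hence "norm (real N *\<^sub>R v) \<le> norm ((\<Sum>i<N. (R ^^ i) w) + ((R ^^ N) y - y))"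
        using v(1) by (intro norm_mono_nonneg) (simp_all add: scaleR_nonneg_nonneg)
      also have "\<dots> \<le> norm (\<Sum>i<N. (R ^^ i) w) + (norm ((R ^^ N) y) + norm y)"
        using norm_triangle_ineq norm_triangle_ineq4 by (meson add_left_mono order_trans)
      also have "norm (\<Sum>i<N. (R ^^ i) w) \<le> (\<Sum>i<N. M * norm w)"
        by (rule order_trans[OF norm_sum sum_mono[OF M]])
      finally show ?thesis using M[of N y] by (simp add: algebra_simps)
    qed
    have "norm v \<le> M * norm w"
    proof (rule ccontr)
      assume "\<not> ?thesis"
      hence "0 < norm v - M * norm w" by simp
      then obtain N :: nat where "(M + 1) * norm y < real N * (norm v - M * norm w)"
        using reals_Archimedean3 by blast
      thus False using main[of N] by (simp add: algebra_simps)
    qed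
    thus ?thesis by (simp add: h_def w_def)
  qed
  have "0 < M"
  proof (rule ccontr)
    assume "\<not> 0 < M"
    hence "M * norm v \<le> 0" by (simp add: mult_nonpos_nonneg)
    moreover have "norm v \<le> M * norm v" using M[of 0 v] by simp
    ultimately have "norm v \<le> 0" by (rule order_trans[rotated])
    thus False using v(2) by simp
  qed
  hence "norm v / M \<le> p v"
    unfolding p_def using norm_v by (intro cINF_greatest) (auto simp: field_simps)
  hence pv: "0 < p v"
    using v(2) \<open>0 < M\<close> by (meson divide_pos_pos less_le_trans zero_less_norm_iff)
  obtain \<phi> where \<phi>: "linear \<phi>" "\<And>x. \<phi> x \<le> p x" "\<phi> v = p v"
    by (rule Hahn_Banach_sublinear[OF sub, of v]) blast
  show thesis
  proof (rule that[OF \<phi>(1)])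
    show "\<phi> x \<le> norm (pprt x)" for x
      using \<phi>(2)[of x] low[of x 0] by (simp add: h_def linear_0[OF lin])
    have le: "\<phi> x \<le> \<phi> (R x)" for x
      using \<phi>(2)[of "x - R x"] low[of "x - R x" "- x"]
      by (simp add: h_def linear_diff[OF \<phi>(1)] linear_neg[OF lin])
    show "\<phi> (R x) = \<phi> x" for x
      using le[of x] le[of "- x"] by (simp add: linear_neg[OF lin] linear_neg[OF \<phi>(1)])
    show "0 < \<phi> v" using pv \<phi>(3) by simp
  qed
qed


section \<open>Rotations of the complex plane spanned by an eigenvector\<close>

lemma unimodular_recurrence:
  fixes \<mu> :: complex
  assumes \<mu>: "cmod \<mu> = 1" and e: "0 < e"
  obtains d where "d \<ge> n" "cmod (\<mu> ^ d - 1) < e"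
proof -
  have "bounded (range (\<lambda>k. \<mu> ^ k))"
    by (rule boundedI[of _ 1]) (auto simp: norm_power \<mu>)
  then obtain l r where r: "strict_mono (r :: nat \<Rightarrow> nat)" "((\<lambda>k. \<mu> ^ k) \<circ> r) \<longlonglongrightarrow> l"
    using bounded_imp_convergent_subsequence by blast
  have "Cauchy ((\<lambda>k. \<mu> ^ k) \<circ> r)" using r(2) by (rule LIMSEQ_imp_Cauchy)
  then obtain K where K: "\<And>i j. i \<ge> K \<Longrightarrow> j \<ge> K \<Longrightarrow> dist (\<mu> ^ r i) (\<mu> ^ r j) < e"
    using metric_CauchyD[OF _ e] by (metis comp_apply)
  define j where "j = K + n + r K"
  have "n + r K \<le> r j" using seq_suble[OF r(1), of j] by (simp add: j_def)
  hence "\<mu> ^ r j - \<mu> ^ r K = \<mu> ^ r K * (\<mu> ^ (r j - r K) - 1)"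
    by (simp add: right_diff_distrib flip: power_add)
  hence "cmod (\<mu> ^ r j - \<mu> ^ r K) = cmod (\<mu> ^ (r j - r K) - 1)"
    by (simp add: norm_mult norm_power \<mu>)
  hence "cmod (\<mu> ^ (r j - r K) - 1) < e"
    using K[of j K] by (simp add: j_def dist_norm)
  moreover have "n \<le> r j - r K" using \<open>n + r K \<le> r j\<close> by simp
  ultimately show thesis using that by blast
qed

lemma midpoint_norm_less_1:
  fixes \<mu> :: complex
  assumes "cmod \<mu> = 1" "\<mu> \<noteq> 1"
  shows "cmod (1 + \<mu>) < 2"
proof -
  have sq: "(Re \<mu>)\<^sup>2 + (Im \<mu>)\<^sup>2 = 1" using assms(1) by (simp add: cmod_def)
  have "Re \<mu> \<noteq> 1" using sq assms(2) by (auto simp: complex_eq_iff)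
  moreover have "Re \<mu> \<le> 1" using complex_Re_le_cmod[of \<mu>] assms(1) by simp
  ultimately have "(cmod (1 + \<mu>))\<^sup>2 < 2\<^sup>2"
    using sq by (simp add: cmod_power2 power2_sum)
  thus ?thesis by (rule power2_less_imp_less) simp
qed

lemma re_part_scaleC_le: "re_part (c *\<^sub>C z) \<le> cmod c *\<^sub>R real_modulus z"
  using order_trans[OF abs_ge_self real_modulus_ge_re[of "c *\<^sub>C z"]] by (simp add: real_modulus_scaleC)

lemma real_modulus_le:
  assumes "\<And>c. cmod c = 1 \<Longrightarrow> re_part (c *\<^sub>C z) \<le> w"
  shows "real_modulus z \<le> w"
proof (rule real_modulus_least)
  fix \<theta>
  show "cos \<theta> *\<^sub>R re_part z + sin \<theta> *\<^sub>R im_part z \<le> w"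
    using assms[of "cis (- \<theta>)"] by simp
qed

text \<open>The positive parts of \<open>a\<close> and \<open>b\<close> are disjoint: \<open>b \<le> - a\<close> gives \<open>pprt b \<le> pprt a - a\<close>, and the meet
  of \<open>pprt a\<close> and \<open>pprt a - a\<close>, the positive and the negative part of \<open>a\<close>, is \<open>0\<close>. Scaling one of them
  does not matter.\<close>

lemma pprt_disjoint:
  fixes a b t :: "'a::banach_lattice"
  assumes ab: "a + b \<le> 0" and t: "t \<le> pprt a" "t \<le> k *\<^sub>R pprt b" and k: "1 \<le> k"
  shows "t \<le> 0"
proof -
  define s where "s = inverse k *\<^sub>R t"
  have k0: "0 < k" using k by simp
  have "pprt a \<le> k *\<^sub>R pprt a"
    using scaleR_right_mono[OF k, of "pprt a"] by simp
  hence "t \<le> k *\<^sub>R pprt a" by (rule order_trans[OF t(1)])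
  moreover have "s \<le> w" if "t \<le> k *\<^sub>R w" for w
    using scaleR_left_mono[OF that, of "inverse k"] k0 by (simp add: s_def)
  ultimately have sa: "s \<le> pprt a" and sb: "s \<le> pprt b" using t(2) by blast+
  have "b \<le> - a" using add_left_mono[OF ab, of "- a"] by (simp add: algebra_simps)
  also have "- a \<le> pprt a - a" by simp
  finally have "b \<le> pprt a - a" .
  moreover have "0 \<le> pprt a - a" by (simp add: pprt_def)
  ultimately have "pprt b \<le> pprt a - a" by (simp add: pprt_def)
  hence "s \<le> pprt a - a" using sb by (rule order_trans[rotated])
  hence "a \<le> pprt a - s" by (simp add: algebra_simps)
  moreover have "0 \<le> pprt a - s" using sa by simp
  ultimately have "pprt a \<le> pprt a - s" by (simp add: pprt_def)
  hence "s \<le> 0" by simp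
  hence "k *\<^sub>R s \<le> 0" using k0 scaleR_left_mono[of s 0 k] by simp
  thus ?thesis using k0 by (simp add: s_def)
qed

text \<open>The heart of the matter. Let \<open>v\<close> be the modulus of \<open>z\<close> and let \<open>\<phi>\<close> be an invariant positive functional
  with \<open>\<phi> v > 0\<close>. The truncations \<open>g c = pprt (X c - \<kappa> *\<^sub>R v)\<close> of the real parts \<open>X c\<close> of \<open>c *\<^sub>C z\<close> pick
  out the places at which the argument of \<open>z\<close> is close to \<open>- Arg c\<close>. With \<open>\<kappa> = cmod (1 + \<mu>) / 2\<close> the windows
  of \<open>c\<close> and \<open>c * \<mu>\<close> do not overlap, and \<open>\<kappa> < 1\<close> because \<open>\<mu> \<noteq> 1\<close>. Up to elements on which \<open>\<phi>\<close>
  vanishes, \<open>R\<close> moves \<open>g c\<close> to \<open>g (c * \<mu>)\<close>, so consecutive orbit elements of \<open>g c\<close> are disjoint for \<open>\<phi>\<close>.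
  The support hypothesis then forces \<open>\<phi> (g c) = 0\<close> for every \<open>c\<close>, which bounds \<open>v\<close>
  by \<open>\<kappa> *\<^sub>R v\<close> as far as \<open>\<phi>\<close> can see.\<close>

lemma no_nontrivial_rotation:
  fixes R :: "'a::banach_lattice \<Rightarrow> 'a"
  assumes lin: "linear R" and pos: "\<And>x. 0 \<le> x \<Longrightarrow> 0 \<le> R x"
    and M: "\<And>n x. norm ((R ^^ n) x) \<le> M * norm x"
    and support: "\<And>g. 0 \<le> g \<Longrightarrow> \<exists>n. \<forall>e>0. \<exists>k y. \<bar>y\<bar> \<le> k *\<^sub>R (R ^^ Suc n) g \<and> norm ((R ^^ n) g - y) < e"
    and rot: "\<And>c. R (re_part (c *\<^sub>C z)) = re_part ((c * \<mu>) *\<^sub>C z)"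
    and \<mu>: "cmod \<mu> = 1" "\<mu> \<noteq> 1"
  shows "z = 0"
proof (rule ccontr)
  assume "z \<noteq> 0"
  define v where "v = real_modulus z"
  define X where "X c = re_part (c *\<^sub>C z)" for c
  have v: "0 \<le> v" "v \<noteq> 0"
    using \<open>z \<noteq> 0\<close> by (simp_all add: v_def real_modulus_nonneg real_modulus_eq_0_iff)
  have X_le: "X c \<le> cmod c *\<^sub>R v" for c unfolding X_def v_def by (rule re_part_scaleC_le)
  have X_add: "X (c + d) = X c + X d" and X_diff: "X (c - d) = X c - X d" for c d
    by (simp_all add: X_def algebra_simps)
  have v_le: "v \<le> w" if "\<And>c. cmod c = 1 \<Longrightarrow> X c \<le> w" for w
    unfolding v_def using that unfolding X_def by (rule real_modulus_le)
  note linn = linear_funpow[OF lin]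
  have posn: "0 \<le> (R ^^ n) x" if "0 \<le> x" for n x using that by (intro funpow_nonneg pos)
  have Rn_X: "(R ^^ n) (X c) = X (c * \<mu> ^ n)" for n c
  proof (induction n arbitrary: c)
    case (Suc n)
    have "(R ^^ Suc n) (X c) = R (X (c * \<mu> ^ n))" using Suc by simp
    also have "\<dots> = X (c * \<mu> ^ Suc n)" unfolding X_def rot by (simp only: power_Suc2 mult.assoc)
    finally show ?case .
  qed simp
  have "X c \<le> R v" if c: "cmod c = 1" for c
  proof -
    have \<mu>0: "\<mu> \<noteq> 0" using \<mu>(1) by auto
    have "X c = X (c / \<mu> * \<mu>)" using \<mu>0 by simp
    also have "\<dots> = R (X (c / \<mu>))" unfolding X_def rot ..
    also have "\<dots> \<le> R v"
      using X_le[of "c / \<mu>"] c \<mu>(1) by (intro linear_mono[OF lin pos]) (simp_all add: norm_divide)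
    finally show ?thesis .
  qed
  hence "v \<le> R v" by (rule v_le)
  then obtain \<phi> where \<phi>: "linear \<phi>" "\<And>x. \<phi> x \<le> norm (pprt x)" "\<And>x. \<phi> (R x) = \<phi> x" "0 < \<phi> v"
    using invariant_positive_functional[OF lin pos M v] by blast
  note \<phi>nn = dominated_functional_nonneg[OF \<phi>(1,2)]
  have \<phi>mono: "\<phi> x \<le> \<phi> y" if "x \<le> y" for x y by (rule linear_mono[OF \<phi>(1) \<phi>nn that])
  note \<phi>lin = linear_add[OF \<phi>(1)] linear_diff[OF \<phi>(1)] linear_scale[OF \<phi>(1)]
  have \<phi>n: "\<phi> ((R ^^ n) x) = \<phi> x" for n x by (induction n) (simp_all add: \<phi>(3))
  define \<kappa> where "\<kappa> = cmod (1 + \<mu>) / 2"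
  have \<kappa>: "0 \<le> \<kappa>" "\<kappa> < 1" using midpoint_norm_less_1[OF \<mu>] by (simp_all add: \<kappa>_def)
  define g where "g c = pprt (X c - \<kappa> *\<^sub>R v)" for c
  have g0: "0 \<le> g c" and X_g: "X c \<le> g c + \<kappa> *\<^sub>R v" for c
    by (simp_all add: g_def pprt_def flip: diff_le_eq)
  have g_near: "g c \<le> g d + cmod (c - d) *\<^sub>R v" for c d
  proof -
    have "X c - \<kappa> *\<^sub>R v \<le> g d + cmod (c - d) *\<^sub>R v"
      using add_mono[OF X_g[of d] X_le[of "c - d"]] by (simp add: X_diff algebra_simps)
    moreover have "0 \<le> g d + cmod (c - d) *\<^sub>R v"
      using g0 v(1) by (simp add: add_nonneg_nonneg scaleR_nonneg_nonneg)
    ultimately show ?thesis unfolding g_def[of c] by (simp add: pprt_def)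
  qed
  \<comment> \<open>The defect between \<open>(R ^^ n) (g c)\<close> and \<open>g (c * \<mu> ^ n)\<close>. The term with \<open>(R ^^ n) v - v\<close> is there because \<open>v\<close>
    may increase under \<open>R\<close>; by invariance of \<open>\<phi>\<close> it contributes nothing.\<close>
  define d where "d n c = (R ^^ n) (g c) + \<kappa> *\<^sub>R ((R ^^ n) v - v) - g (c * \<mu> ^ n)" for n c
  have d0: "0 \<le> d n c" for n c
  proof -
    have w0: "0 \<le> \<kappa> *\<^sub>R ((R ^^ n) v - v)"
      using \<kappa>(1) funpow_ge[OF lin pos \<open>v \<le> R v\<close>] by (simp add: scaleR_nonneg_nonneg)
    have "X (c * \<mu> ^ n) = (R ^^ n) (X c)" by (simp add: Rn_X)
    also have "\<dots> \<le> (R ^^ n) (g c + \<kappa> *\<^sub>R v)" by (rule linear_mono[OF linn posn X_g])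
    also have "\<dots> = (R ^^ n) (g c) + \<kappa> *\<^sub>R (R ^^ n) v"
      by (simp add: linear_add[OF linn] linear_scale[OF linn])
    finally have "X (c * \<mu> ^ n) - \<kappa> *\<^sub>R v \<le> (R ^^ n) (g c) + \<kappa> *\<^sub>R ((R ^^ n) v - v)"
      by (simp add: algebra_simps)
    moreover have "0 \<le> (R ^^ n) (g c) + \<kappa> *\<^sub>R ((R ^^ n) v - v)"
      using w0 posn[OF g0] by (rule add_nonneg_nonneg[rotated])
    ultimately have "g (c * \<mu> ^ n) \<le> (R ^^ n) (g c) + \<kappa> *\<^sub>R ((R ^^ n) v - v)"
      unfolding g_def[of "c * \<mu> ^ n"] pprt_def by simp
    thus ?thesis unfolding d_def by simp
  qed
  have \<phi>d: "\<phi> (d n c) = \<phi> (g c) - \<phi> (g (c * \<mu> ^ n))" for n c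
    by (simp add: d_def \<phi>lin \<phi>n)
  have \<phi>g_dec: "\<phi> (g (c * \<mu> ^ n)) \<le> \<phi> (g c)" for n c
    using \<phi>nn[OF d0, of n c] by (simp add: \<phi>d)
  \<comment> \<open>A decrease would be irreversible, but some later power of \<open>\<mu>\<close> returns close to \<open>1\<close>.\<close>
  have \<phi>g_const: "\<phi> (g (c * \<mu> ^ n)) = \<phi> (g c)" if c: "cmod c = 1" for n c
  proof (rule order.antisym[OF \<phi>g_dec], rule field_le_epsilon)
    fix e :: real assume "0 < e"
    hence e: "0 < e / \<phi> v" using \<phi>(4) by simp
    obtain m where m: "m \<ge> n" "cmod (\<mu> ^ m - 1) < e / \<phi> v"
      by (rule unimodular_recurrence[OF \<mu>(1) e])
    have cm: "cmod (c - c * \<mu> ^ m) = cmod (\<mu> ^ m - 1)"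
    proof -
      have "c - c * \<mu> ^ m = - (c * (\<mu> ^ m - 1))" by (simp add: algebra_simps)
      thus ?thesis by (simp only: norm_minus_cancel norm_mult c mult_1)
    qed
    have "\<phi> (g c) \<le> \<phi> (g (c * \<mu> ^ m) + cmod (\<mu> ^ m - 1) *\<^sub>R v)"
      using g_near[of c "c * \<mu> ^ m"] by (intro \<phi>mono) (simp add: cm)
    also have "\<dots> = \<phi> (g ((c * \<mu> ^ n) * \<mu> ^ (m - n))) + cmod (\<mu> ^ m - 1) * \<phi> v"
      using m(1) by (simp add: \<phi>lin mult.assoc flip: power_add)
    also have "\<dots> \<le> \<phi> (g (c * \<mu> ^ n)) + e"
      using \<phi>g_dec[of "c * \<mu> ^ n" "m - n"] m(2) \<phi>(4) by (intro add_mono) (simp_all add: field_simps)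
    finally show "\<phi> (g c) \<le> \<phi> (g (c * \<mu> ^ n)) + e" .
  qed
  have \<phi>d0: "\<phi> (d n c) = 0" if "cmod c = 1" for n c
    using that by (simp add: \<phi>d \<phi>g_const)
  have \<phi>g0: "\<phi> (g c) = 0" if c: "cmod c = 1" for c
  proof -
    obtain n where n: "\<And>e. 0 < e \<Longrightarrow>
        \<exists>k y. \<bar>y\<bar> \<le> k *\<^sub>R (R ^^ Suc n) (g c) \<and> norm ((R ^^ n) (g c) - y) < e"
      using support[OF g0] by blast
    define a where "a = (R ^^ n) (g c)"
    define b where "b = (R ^^ Suc n) (g c)"
    have a0: "0 \<le> a" and b0: "0 \<le> b" by (simp_all only: a_def b_def posn g0)
    have "\<phi> a \<le> e" if e: "0 < e" for e
    proof -
      obtain k' y where y: "\<bar>y\<bar> \<le> k' *\<^sub>R b" "norm (a - y) < e"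
        using n[OF e] unfolding a_def b_def by blast
      define k where "k = max 1 k'"
      have k: "1 \<le> k" by (simp add: k_def)
      have yk: "\<bar>y\<bar> \<le> k *\<^sub>R b"
        by (rule order_trans[OF y(1) scaleR_right_mono[OF _ b0]]) (simp add: k_def)
      \<comment> \<open>Split \<open>a\<close> into its meet with \<open>\<bar>y\<bar>\<close>, which \<open>\<phi>\<close> cannot see, and a remainder of small norm.\<close>
      define t where "t = inf a \<bar>y\<bar>"
      have ta: "t \<le> a" and ty: "t \<le> k *\<^sub>R b"
        using yk by (simp_all add: t_def le_infI2)
      have "\<phi> t \<le> 0"
      proof -
        define u where "u = t - d n c - k *\<^sub>R d (Suc n) c"
        define W where "W m = \<kappa> *\<^sub>R ((R ^^ m) v - v)" for m
        have W0: "0 \<le> W m" for m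
          using \<kappa>(1) funpow_ge[OF lin pos \<open>v \<le> R v\<close>] by (simp add: W_def scaleR_nonneg_nonneg)
        have ad: "a - d n c \<le> g (c * \<mu> ^ n)" "b - d (Suc n) c \<le> g (c * \<mu> ^ Suc n)"
          using W0[of n] W0[of "Suc n"] unfolding a_def b_def d_def W_def by simp_all
        have "u \<le> a - d n c"
          using add_mono[OF ta scaleR_nonneg_nonneg[of k "d (Suc n) c"]] k d0[of "Suc n" c]
          by (simp add: u_def diff_diff_eq add_increasing2 algebra_simps)
        hence ua: "u \<le> g (c * \<mu> ^ n)" using ad(1) by (rule order_trans)
        have ub: "u \<le> k *\<^sub>R g (c * \<mu> ^ Suc n)"
        proof -
          have "u \<le> k *\<^sub>R b - k *\<^sub>R d (Suc n) c"
            using add_mono[OF ty d0[of n c]] by (simp add: u_def algebra_simps)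
          also have "\<dots> = k *\<^sub>R (b - d (Suc n) c)" by (simp add: algebra_simps)
          also have "\<dots> \<le> k *\<^sub>R g (c * \<mu> ^ Suc n)"
            using k ad(2) by (intro scaleR_left_mono) simp_all
          finally show ?thesis .
        qed
        have disj: "(X (c * \<mu> ^ n) - \<kappa> *\<^sub>R v) + (X (c * \<mu> ^ Suc n) - \<kappa> *\<^sub>R v) \<le> 0"
        proof -
          have "X (c * \<mu> ^ n) + X (c * \<mu> ^ Suc n) = X (c * \<mu> ^ n * (1 + \<mu>))"
            by (simp add: algebra_simps flip: X_add)
          also have "\<dots> \<le> (2 * \<kappa>) *\<^sub>R v"
            using X_le[of "c * \<mu> ^ n * (1 + \<mu>)"] by (simp add: \<kappa>_def norm_mult norm_power c \<mu>(1))
          finally show ?thesis by (simp add: algebra_simps flip: scaleR_2)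
        qed
        have "u \<le> 0" by (rule pprt_disjoint[OF disj ua[unfolded g_def] ub[unfolded g_def] k])
        hence "\<phi> u \<le> \<phi> 0" by (rule \<phi>mono)
        thus ?thesis using c by (simp add: u_def \<phi>lin \<phi>d0 linear_0[OF \<phi>(1)])
      qed
      moreover have "\<phi> (a - t) \<le> e"
      proof -
        have "a - t \<le> \<bar>a - y\<bar>"
        proof -
          have "a - \<bar>a - y\<bar> \<le> a" by simp
          moreover have "a - \<bar>a - y\<bar> \<le> \<bar>y\<bar>"
            using abs_triangle_ineq[of "a - y" y] abs_ge_self[of a] by (simp add: algebra_simps)
          ultimately have "a - \<bar>a - y\<bar> \<le> t" by (simp add: t_def)
          thus ?thesis by (simp add: algebra_simps)
        qed
        hence "\<phi> (a - t) \<le> \<phi> \<bar>a - y\<bar>" by (rule \<phi>mono)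
        also have "\<dots> \<le> norm (a - y)"
          using \<phi>(2)[of "\<bar>a - y\<bar>"] by (simp add: norm_abs_lattice)
        finally show ?thesis using y(2) by simp
      qed
      ultimately show ?thesis by (simp add: \<phi>lin)
    qed
    hence "\<phi> a \<le> 0" by (metis field_le_epsilon add_0)
    thus ?thesis using \<phi>nn[OF g0, of c] by (simp add: a_def \<phi>n)
  qed
  \<comment> \<open>Finitely many directions determine \<open>v\<close> up to \<open>\<epsilon> *\<^sub>R v\<close>, so the supremum defining \<open>v\<close> is within reach of
    the linear functional \<open>\<phi>\<close>.\<close>
  define \<epsilon> where "\<epsilon> = (1 - \<kappa>) / 2"
  have \<epsilon>: "0 < \<epsilon>" "\<kappa> + \<epsilon> < 1" using \<kappa> by (simp_all add: \<epsilon>_def field_simps)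
  obtain F where F: "F \<subseteq> sphere (0::complex) 1" "finite F" "sphere (0::complex) 1 \<subseteq> (\<Union>c\<in>F. ball c \<epsilon>)"
  proof (rule compactE_image[of "sphere (0::complex) 1" "sphere 0 1" "\<lambda>c. ball c \<epsilon>"])
    show "sphere (0::complex) 1 \<subseteq> (\<Union>c\<in>sphere 0 1. ball c \<epsilon>)" using \<epsilon>(1) by force
  qed auto
  have "v \<le> (\<Sum>c\<in>F. g c) + (\<kappa> + \<epsilon>) *\<^sub>R v"
  proof (rule v_le)
    fix b assume "cmod b = 1"
    then obtain c where c: "c \<in> F" "cmod (c - b) < \<epsilon>"
      using F(3) by (auto simp: subset_iff dist_norm)
    have "X b = X c + X (b - c)" by (simp add: X_diff)
    also have "\<dots> \<le> (g c + \<kappa> *\<^sub>R v) + \<epsilon> *\<^sub>R v"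
    proof (rule add_mono[OF X_g])
      show "X (b - c) \<le> \<epsilon> *\<^sub>R v"
        using c(2) by (intro order_trans[OF X_le scaleR_right_mono[OF _ v(1)]])
          (simp add: norm_minus_commute)
    qed
    also have "g c \<le> (\<Sum>c\<in>F. g c)"
      using sum_mono2[OF F(2), of "{c}" g] c(1) g0 by simp
    finally show "X b \<le> (\<Sum>c\<in>F. g c) + (\<kappa> + \<epsilon>) *\<^sub>R v" by (simp add: algebra_simps)
  qed
  hence "\<phi> v \<le> \<phi> ((\<Sum>c\<in>F. g c) + (\<kappa> + \<epsilon>) *\<^sub>R v)" by (rule \<phi>mono)
  also have "\<dots> = (\<Sum>c\<in>F. \<phi> (g c)) + (\<kappa> + \<epsilon>) * \<phi> v"
    by (simp add: \<phi>lin linear_sum[OF \<phi>(1)])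
  also have "(\<Sum>c\<in>F. \<phi> (g c)) = 0"
    using F(1) by (intro sum.neutral) (auto simp: \<phi>g0 subset_iff)
  finally have "\<phi> v \<le> (\<kappa> + \<epsilon>) * \<phi> v" by simp
  thus False using \<epsilon>(2) \<phi>(4) by simp
qed


section \<open>Operators on the complexification and weak boundedness of orbits\<close>

text \<open>A positive complex-linear operator maps real elements to real elements, because these are differences
  of positive ones. It is therefore the complexification of a positive operator on the real part.\<close>

lemma positive_operator_real:
  fixes T :: "'a::banach_lattice complexification \<Rightarrow> 'a complexification"
  assumes T: "linear_operator T" "positive_operator T"
  obtains R where "linear R" "\<And>x. 0 \<le> x \<Longrightarrow> 0 \<le> R x" "\<And>x y. T (Cplx x y) = Cplx (R x) (R y)"
proof -
  interpret T: Vector_Spaces.linear scaleC scaleC T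
    using T(1) by (simp add: linear_operator_def)
  define R where "R x = re_part (T (Cplx x 0))" for x
  have pos: "0 \<le> R x" "im_part (T (Cplx x 0)) = 0" if "0 \<le> x" for x
  proof -
    have "0 \<le> Cplx x 0" using that by (simp add: less_eq_complexification_def)
    hence "0 \<le> T (Cplx x 0)" using T(2) by (auto simp: positive_operator_def)
    thus "0 \<le> R x" "im_part (T (Cplx x 0)) = 0"
      by (simp_all add: less_eq_complexification_def R_def)
  qed
  have im: "im_part (T (Cplx x 0)) = 0" for x
  proof -
    have "Cplx (pprt x) 0 = Cplx x 0 + Cplx (pprt (- x)) 0"
      using prts[of x] by (simp add: complexification_eq_iff pprt_neg eq_diff_eq)
    hence "T (Cplx (pprt x) 0) = T (Cplx x 0) + T (Cplx (pprt (- x)) 0)" by (simp add: T.add)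
    thus ?thesis
      using pos(2)[of "pprt x"] pos(2)[of "pprt (- x)"] by (simp add: complexification_eq_iff)
  qed
  have real: "T (Cplx x 0) = Cplx (R x) 0" for x
    by (simp add: complexification_eq_iff R_def im)
  show thesis
  proof (rule that[OF _ pos(1)])
    show "linear R"
    proof (rule linearI)
      fix x y :: 'a and r :: real
      have "Cplx (x + y) 0 = Cplx x 0 + Cplx y 0" by (simp add: complexification_eq_iff)
      thus "R (x + y) = R x + R y" unfolding R_def by (simp add: T.add)
      have "Cplx (r *\<^sub>R x) 0 = complex_of_real r *\<^sub>C Cplx x 0"
        by (simp add: complexification_eq_iff)
      thus "R (r *\<^sub>R x) = r *\<^sub>R R x" unfolding R_def by (simp add: T.scale)
    qed
    show "T (Cplx x y) = Cplx (R x) (R y)" for x y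
    proof -
      have "Cplx x y = Cplx x 0 + \<i> *\<^sub>C Cplx y 0" by (simp add: complexification_eq_iff)
      hence "T (Cplx x y) = T (Cplx x 0) + \<i> *\<^sub>C T (Cplx y 0)" by (simp only: T.add T.scale)
      thus ?thesis by (simp add: real complexification_eq_iff)
    qed
  qed
qed

lemma funpow_complexification:
  fixes R :: "'a \<Rightarrow> 'a"
  assumes "\<And>x y. T (Cplx x y) = Cplx (R x) (R y)"
  shows "(T ^^ n) (Cplx x y) = Cplx ((R ^^ n) x) ((R ^^ n) y)"
  by (induction n) (simp_all add: assms)

lemma complexified_functional_in_dual_space:
  fixes \<psi> :: "'a::banach_lattice \<Rightarrow> real"
  assumes "bounded_linear \<psi>"
  shows "(\<lambda>z. Complex (\<psi> (re_part z)) (\<psi> (im_part z))) \<in> dual_space"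
proof -
  interpret \<psi>: bounded_linear \<psi> by (rule assms)
  let ?\<Phi> = "\<lambda>z. Complex (\<psi> (re_part z)) (\<psi> (im_part z))"
  have lin: "Vector_Spaces.linear scaleC (*) ?\<Phi>"
    by unfold_locales (simp_all add: complex_eq_iff \<psi>.add \<psi>.diff \<psi>.scale algebra_simps)
  have re: "bounded_linear (re_part :: 'a complexification \<Rightarrow> 'a)"
    and im: "bounded_linear (im_part :: 'a complexification \<Rightarrow> 'a)"
    by (rule bounded_linear_intro[where K = 1]; simp add: norm_re_part_le norm_im_part_le)+
  have "continuous_on UNIV (\<lambda>z. complex_of_real (\<psi> (re_part z)) + \<i> * complex_of_real (\<psi> (im_part z)))"
    by (intro continuous_intros \<psi>.continuous_on bounded_linear.continuous_on[OF re]
        bounded_linear.continuous_on[OF im])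
  thus ?thesis using lin by (simp add: dual_space_def flip: Complex_eq)
qed

lemma relatively_weakly_compact_bounded:
  fixes S :: "'a::banach_lattice complexification set"
  assumes S: "relatively_compact_in weak_topology S" and \<Phi>: "\<Phi> \<in> dual_space"
  shows "bounded (\<Phi> ` S)"
proof -
  have "open U \<Longrightarrow> openin weak_topology (\<Phi> -` U)" for U
    unfolding weak_topology_def using \<Phi> by (intro topology_generated_by_Basis) auto
  hence "openin weak_topology (topspace weak_topology \<inter> \<Phi> -` U)" if "open U" for U
    using that by blast
  hence "continuous_map weak_topology euclidean \<Phi>"
    by (simp add: continuous_map_def vimage_def Int_def)
  hence "compactin euclidean (\<Phi> ` (weak_topology closure_of S))"
    using S by (intro image_compactin) (auto simp: relatively_compact_in_def)
  hence "bounded (\<Phi> ` (weak_topology closure_of S))" by (simp add: compact_imp_bounded)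
  moreover have "S \<subseteq> weak_topology closure_of S"
    using S by (intro closure_of_subset) (simp add: relatively_compact_in_def)
  ultimately show ?thesis by (meson bounded_subset image_mono)
qed

text \<open>A continuous functional is bounded on weakly compact sets. Applied to complexified real functionals,
  this supplies the scalar bounds along orbits that the gliding hump turns into a bound for the powers.\<close>

lemma weakly_almost_periodic_power_bounded:
  fixes T :: "'a::banach_lattice complexification \<Rightarrow> 'a complexification"
  assumes wap: "weakly_almost_periodic T"
    and R: "linear R" "\<And>x. 0 \<le> x \<Longrightarrow> 0 \<le> R x" "\<And>x y. T (Cplx x y) = Cplx (R x) (R y)"
  shows "\<exists>M. \<forall>n x. norm ((R ^^ n) x) \<le> M * norm x"
proof (rule positive_power_bounded[OF R(1,2)])
  show "\<exists>B. \<forall>n. \<psi> ((R ^^ n) x) \<le> B" if "bounded_linear \<psi>" for \<psi> :: "'a \<Rightarrow> real" and x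
  proof -
    let ?\<Phi> = "\<lambda>z. Complex (\<psi> (re_part z)) (\<psi> (im_part z))"
    have "relatively_compact_in weak_topology (range (\<lambda>n. (T ^^ n) (Cplx x 0)))"
      using wap by (simp add: weakly_almost_periodic_def)
    hence "bounded (?\<Phi> ` range (\<lambda>n. (T ^^ n) (Cplx x 0)))"
      by (rule relatively_weakly_compact_bounded[OF _ complexified_functional_in_dual_space[OF that]])
    then obtain B where "\<And>n. cmod (?\<Phi> ((T ^^ n) (Cplx x 0))) \<le> B"
      unfolding bounded_iff by auto
    hence "\<psi> ((R ^^ n) x) \<le> B" for n
      using complex_Re_le_cmod order_trans
      by (metis funpow_complexification[of T R, OF R(3)] complex.sel(1) complexification.sel(1))
    thus ?thesis by blast
  qed
qed

lemma principal_ideal_real: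
  "h \<in> principal_ideal (Cplx b 0) \<longleftrightarrow> (\<exists>k\<ge>0. real_modulus h \<le> k *\<^sub>R b)"
  by (simp add: principal_ideal_def abs_complexification_def less_eq_complexification_def)

text \<open>The inclusion is read off at the generator \<open>a\<close>. Taking real parts of the approximating elements of the
  ideal neither increases the distance to \<open>a\<close> nor the modulus.\<close>

lemma closure_principal_ideal_approx:
  fixes a b :: "'a::banach_lattice"
  assumes a: "0 \<le> a" and e: "0 < e"
    and sub: "closure (principal_ideal (Cplx a 0)) \<subseteq> closure (principal_ideal (Cplx b 0))"
  obtains k y where "\<bar>y\<bar> \<le> k *\<^sub>R b" "norm (a - y) < e"
proof -
  have "Cplx a 0 \<in> principal_ideal (Cplx a 0)"
    using a by (auto simp: principal_ideal_real real_modulus_real intro!: exI[of _ 1])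
  hence "Cplx a 0 \<in> closure (principal_ideal (Cplx b 0))"
    using sub closure_subset by blast
  then obtain h where h: "h \<in> principal_ideal (Cplx b 0)" "dist h (Cplx a 0) < e"
    using e unfolding closure_approachable by blast
  obtain k where "real_modulus h \<le> k *\<^sub>R b" using h(1) by (auto simp: principal_ideal_real)
  hence "\<bar>re_part h\<bar> \<le> k *\<^sub>R b" by (rule order_trans[OF real_modulus_ge_re])
  moreover have "norm (a - re_part h) < e"
    using norm_re_part_le[of "Cplx a 0 - h"] h(2) by (simp add: dist_norm norm_minus_commute)
  ultimately show thesis by (rule that)
qed


section \<open>Triviality of the peripheral point spectrum\<close>

theorem theorem2p1:
  fixes T :: "'a::banach_lattice complexification \<Rightarrow> 'a complexification"
  assumes "linear_operator T"
    and "positive_operator T"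
    and "weakly_almost_periodic T"
    and "\<And>f. 0 \<le> f \<Longrightarrow>
      \<exists>n\<ge>1. closure (principal_ideal ((T ^^ n) f)) \<supseteq> closure (principal_ideal ((T ^^ (n - 1)) f))"
  shows "point_spectrum T \<inter> {\<mu>. cmod \<mu> = 1} \<subseteq> {1}"
proof (rule subsetI, rule ccontr)
  fix \<mu> assume "\<mu> \<in> point_spectrum T \<inter> {\<mu>. cmod \<mu> = 1}" and "\<mu> \<notin> {1}"
  then obtain z where z: "z \<noteq> 0" "T z = \<mu> *\<^sub>C z" and \<mu>: "cmod \<mu> = 1" "\<mu> \<noteq> 1"
    by (auto simp: point_spectrum_def)
  interpret T: Vector_Spaces.linear scaleC scaleC T
    using assms(1) by (simp add: linear_operator_def)
  obtain R where R: "linear R" "\<And>x. 0 \<le> x \<Longrightarrow> 0 \<le> R x" "\<And>x y. T (Cplx x y) = Cplx (R x) (R y)"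
    by (rule positive_operator_real[OF assms(1,2)]) blast
  obtain M where M: "\<And>n x. norm ((R ^^ n) x) \<le> M * norm x"
    using weakly_almost_periodic_power_bounded[OF assms(3) R] by blast
  note T_pow = funpow_complexification[of T R, OF R(3)]
  have "\<exists>n. \<forall>e>0. \<exists>k y. \<bar>y\<bar> \<le> k *\<^sub>R (R ^^ Suc n) g \<and> norm ((R ^^ n) g - y) < e" if g: "0 \<le> g" for g
  proof -
    have "0 \<le> Cplx g 0" using g by (simp add: less_eq_complexification_def)
    then obtain n where "n \<ge> 1" and n: "closure (principal_ideal ((T ^^ (n - 1)) (Cplx g 0)))
        \<subseteq> closure (principal_ideal ((T ^^ n) (Cplx g 0)))"
      using assms(4) by blast
    then obtain m where m: "n = Suc m" by (cases n) auto
    have zero: "(R ^^ i) 0 = 0" for i using linear_0[OF linear_funpow[OF R(1)]] .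
    have "0 \<le> (R ^^ m) g" using g by (intro funpow_nonneg R(2))
    moreover have "closure (principal_ideal (Cplx ((R ^^ m) g) 0))
        \<subseteq> closure (principal_ideal (Cplx ((R ^^ Suc m) g) 0))"
      using n unfolding m T_pow zero by simp
    ultimately show ?thesis by (meson closure_principal_ideal_approx)
  qed
  moreover have "R (re_part (c *\<^sub>C z)) = re_part ((c * \<mu>) *\<^sub>C z)" for c
  proof -
    have "T (c *\<^sub>C z) = c *\<^sub>C T z" by (rule T.scale)
    also have "\<dots> = (c * \<mu>) *\<^sub>C z" unfolding z(2) by (rule complexification.scale_scale)
    finally show ?thesis using R(3)[of "re_part (c *\<^sub>C z)" "im_part (c *\<^sub>C z)"]
      by (metis complexification.collapse complexification.sel(1))
  qed
  ultimately have "z = 0" by (intro no_nontrivial_rotation[OF R(1,2) M _ _ \<mu>])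
  thus False using z(1) by simp
qed

end
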